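(* Let $\mathcal R$ and $\mathcal T$ be finite-dimensional operator systems and let $\otimes_\sigma$ be an operator system tensor product structure on $\mathcal R\otimes\mathcal T$. Then the base positive cone $(\mathcal R\otimes_\sigma\mathcal T)_+$ of the operator system $\mathcal R\otimes_\sigma\mathcal T$ satisfies $$\mathcal R_+\otimes_{\rm sep}\mathcal T_+\subseteq(\mathcal R\otimes_\sigma\mathcal T)_+\subseteq\mathcal R_+\otimes_{{\rm sep}^*}\mathcal T_+ .$$ In other words, $(\mathcal R\otimes_\sigma\mathcal T)_+$ is a tensor cone for $\mathcal R_+$ and $\mathcal T_+$.
   Context: For an operator system $\mathcal R$, $\mathcal M_n(\mathcal R)_+$ denotes its $n$-th matrix cone, $\mathcal R_+=\mathcal M_1(\mathcal R)_+$ its base cone, and $e_{\mathcal R}$ its Archimedean order unit; ucp means unital completely positive. An operator system tensor product structure $\sigma$ on the algebraic tensor product $\mathcal R\otimes\mathcal T$ is a family $\{\mathcal C_n\}_{n\in\mathbb N}$ of cones $\mathcal C_n\subseteq\mathcal M_n(\mathcal R\otimes\mathcal T)$ such that: (i) $(\mathcal R\otimes\mathcal T,\{\mathcal C_n\},e_{\mathcal R}\otimes e_{\mathcal T})$ is an operator system, denoted $\mathcal R\otimes_\sigma\mathcal T$; (ii) $a\otimes b\in\mathcal C_{n_1n_2}$ for all $a\in\mathcal M_{n_1}(\mathcal R)_+$, $b\in\mathcal M_{n_2}(\mathcal T)_+$; (iii) for all ucp maps $\phi:\mathcal R\to\mathcal M_{n_1}(\mathbb C)$ and $\psi:\mathcal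 T\to\mathcal M_{n_2}(\mathbb C)$, the map $\phi\otimes\psi:\mathcal R\otimes_\sigma\mathcal T\to\mathcal M_{n_1}(\mathbb C)\otimes\mathcal M_{n_2}(\mathbb C)$ is ucp. Separability cone: $\mathcal R_+\otimes_{\rm sep}\mathcal T_+=\{\sum_{j=1}^k a_j\otimes b_j : k\in\mathbb N,\ a_j\in\mathcal R_+,\ b_j\in\mathcal T_+\}$. Dual separable cone: $\mathcal R_+\otimes_{{\rm sep}^*}\mathcal T_+=\{x\in(\mathcal R\otimes_{\mathbb C}\mathcal T)_{\rm sa} : (\phi\otimes\psi)(x)\ge 0 \text{ for all positive linear functionals }\phi\text{ on }\mathcal R,\ \psi\text{ on }\mathcal T\}$. A tensor cone for $\mathcal R_+$ and $\mathcal T_+$ is a cone lying between the separability cone and the dual separable cone. *)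

theory Defs
  imports
    "HOL-Library.Poly_Mapping"
    "Jordan_Normal_Form.Matrix"
begin

section \<open>Complex vector spaces with involution\<close>

class complex_vector = ab_group_add +
  fixes scaleC :: "complex \<Rightarrow> 'a \<Rightarrow> 'a" (infixr \<open>*\<^sub>C\<close> 75)
  assumes scaleC_add_right: "c *\<^sub>C (x + y) = c *\<^sub>C x + c *\<^sub>C y"
    and scaleC_add_left: "(c + d) *\<^sub>C x = c *\<^sub>C x + d *\<^sub>C x"
    and scaleC_scaleC: "c *\<^sub>C d *\<^sub>C x = (c * d) *\<^sub>C x"
    and scaleC_one: "1 *\<^sub>C x = x"

global_interpretation complex_vector: vector_space "scaleC :: complex \<Rightarrow> 'a \<Rightarrow> 'a::complex_vector"
  by unfold_locales (simp_all add: scaleC_add_right scaleC_add_left scaleC_scaleC scaleC_one)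

instantiation complex :: complex_vector
begin
definition scaleC_complex_def [simp]: "scaleC c (x :: complex) = c * x"
instance by standard (simp_all add: algebra_simps)
end

class star_vector = complex_vector +
  fixes star :: "'a \<Rightarrow> 'a"
  assumes star_star [simp]: "star (star x) = x"
    and star_add: "star (x + y) = star x + star y"
    and star_scaleC: "star (c *\<^sub>C x) = cnj c *\<^sub>C star x"

lemma star_0 [simp]: "star 0 = (0 :: 'a::star_vector)"
  using star_add[of "0 :: 'a" 0] by simp


section \<open>The algebraic tensor product\<close>

definition bilinearC :: "('a::complex_vector \<Rightarrow> 'b::complex_vector \<Rightarrow> 'c::complex_vector) \<Rightarrow> bool" where
  "bilinearC f \<longleftrightarrow>
     (\<forall>y. Vector_Spaces.linear scaleC scaleC (\<lambda>x. f x y)) \<and>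
     (\<forall>x. Vector_Spaces.linear scaleC scaleC (\<lambda>y. f x y))"

lemma linearC_iff:
  "Vector_Spaces.linear scaleC scaleC f \<longleftrightarrow>
     (\<forall>x y. f (x + y) = f x + f y) \<and> (\<forall>c x. f (c *\<^sub>C x) = c *\<^sub>C f x)"
  for f :: "'a::complex_vector \<Rightarrow> 'b::complex_vector"
  by (simp add: Vector_Spaces.linear_iff complex_vector.vector_space_axioms)

lemma bilinearC_iff:
  "bilinearC f \<longleftrightarrow>
     (\<forall>x x' y. f (x + x') y = f x y + f x' y) \<and> (\<forall>c x y. f (c *\<^sub>C x) y = c *\<^sub>C f x y) \<and>
     (\<forall>x y y'. f x (y + y') = f x y + f x y') \<and> (\<forall>c x y. f x (c *\<^sub>C y) = c *\<^sub>C f x y)"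
  unfolding bilinearC_def linearC_iff by blast

instantiation poly_mapping :: (type, complex_vector) complex_vector
begin
lift_definition scaleC_poly_mapping :: "complex \<Rightarrow> ('a \<Rightarrow>\<^sub>0 'b) \<Rightarrow> ('a \<Rightarrow>\<^sub>0 'b)"
  is "\<lambda>c f k. c *\<^sub>C f k"
  by (erule rev_finite_subset) auto
instance
  by standard
    (transfer; simp add: fun_eq_iff scaleC_add_right scaleC_add_left scaleC_scaleC scaleC_one)+
end

text \<open>The tensor product is the free complex vector space on pairs, that is,
  \<open>'a \<times> 'b \<Rightarrow>\<^sub>0 complex\<close>, modulo the span of the usual relations.\<close>

abbreviation gen :: "'a \<Rightarrow> 'b \<Rightarrow> ('a \<times> 'b) \<Rightarrow>\<^sub>0 complex" where
  "gen x y \<equiv> Poly_Mapping.single (x, y) 1"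

definition tensor_relations :: "(('a::complex_vector \<times> 'b::complex_vector) \<Rightarrow>\<^sub>0 complex) set" where
  "tensor_relations =
     {gen (x + x') y - gen x y - gen x' y | x x' y. True} \<union>
     {gen x (y + y') - gen x y - gen x y' | x y y'. True} \<union>
     {gen (c *\<^sub>C x) y - c *\<^sub>C gen x y | c x y. True} \<union>
     {gen x (c *\<^sub>C y) - c *\<^sub>C gen x y | c x y. True}"

definition tensor_rel ::
  "(('a::complex_vector \<times> 'b::complex_vector) \<Rightarrow>\<^sub>0 complex) \<Rightarrow> (('a \<times> 'b) \<Rightarrow>\<^sub>0 complex) \<Rightarrow> bool" where
  "tensor_rel p q \<longleftrightarrow> p - q \<in> complex_vector.span tensor_relations"

lemma tensor_rel_eqI: "p = q \<Longrightarrow> tensor_rel p q"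
  by (simp add: tensor_rel_def complex_vector.span_zero)

lemma equivp_tensor_rel:
  "equivp (tensor_rel :: (('a::complex_vector \<times> 'b::complex_vector) \<Rightarrow>\<^sub>0 complex) \<Rightarrow> _)"
proof (rule equivpI)
  show "reflp (tensor_rel :: (('a \<times> 'b) \<Rightarrow>\<^sub>0 complex) \<Rightarrow> _)"
    by (auto intro!: reflpI simp: tensor_rel_def complex_vector.span_zero)
  show "symp (tensor_rel :: (('a \<times> 'b) \<Rightarrow>\<^sub>0 complex) \<Rightarrow> _)"
  proof (rule sympI)
    fix p q :: "('a \<times> 'b) \<Rightarrow>\<^sub>0 complex"
    assume "tensor_rel p q"
    then show "tensor_rel q p"
      using complex_vector.span_neg[of "p - q" tensor_relations] by (simp add: tensor_rel_def)
  qed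
  show "transp (tensor_rel :: (('a \<times> 'b) \<Rightarrow>\<^sub>0 complex) \<Rightarrow> _)"
  proof (rule transpI)
    fix p q r :: "('a \<times> 'b) \<Rightarrow>\<^sub>0 complex"
    assume "tensor_rel p q" "tensor_rel q r"
    then show "tensor_rel p r"
      using complex_vector.span_add[of "p - q" tensor_relations "q - r"]
      by (simp add: tensor_rel_def)
  qed
qed

quotient_type (overloaded) ('a, 'b) tensor =
  "(('a::complex_vector \<times> 'b::complex_vector) \<Rightarrow>\<^sub>0 complex)" / tensor_rel
  by (rule equivp_tensor_rel)

lift_definition tensor :: "'a::complex_vector \<Rightarrow> 'b::complex_vector \<Rightarrow> ('a, 'b) tensor"
    (infixl \<open>\<otimes>\<^sub>t\<close> 70)
  is gen .

instantiation tensor :: (complex_vector, complex_vector) complex_vector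
begin

lift_definition zero_tensor :: "('a, 'b) tensor" is 0 .

lift_definition plus_tensor :: "('a, 'b) tensor \<Rightarrow> ('a, 'b) tensor \<Rightarrow> ('a, 'b) tensor" is "(+)"
  unfolding tensor_rel_def by (simp only: add_diff_add complex_vector.span_add)

lift_definition uminus_tensor :: "('a, 'b) tensor \<Rightarrow> ('a, 'b) tensor" is uminus
  unfolding tensor_rel_def by (simp only: minus_diff_minus complex_vector.span_neg)

lift_definition minus_tensor :: "('a, 'b) tensor \<Rightarrow> ('a, 'b) tensor \<Rightarrow> ('a, 'b) tensor" is "(-)"
  unfolding tensor_rel_def
proof -
  fix p p' q q' :: "('a \<times> 'b) \<Rightarrow>\<^sub>0 complex"
  assume "p - p' \<in> complex_vector.span tensor_relations"
    and "q - q' \<in> complex_vector.span tensor_relations"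
  then have "(p - p') - (q - q') \<in> complex_vector.span tensor_relations"
    by (rule complex_vector.span_diff)
  then show "p - q - (p' - q') \<in> complex_vector.span tensor_relations"
    by (simp add: algebra_simps)
qed

lift_definition scaleC_tensor :: "complex \<Rightarrow> ('a, 'b) tensor \<Rightarrow> ('a, 'b) tensor" is scaleC
  unfolding tensor_rel_def
  by (simp only: complex_vector.scale_right_diff_distrib[symmetric] complex_vector.span_scale)

instance
proof
  fix a b c :: "('a, 'b) tensor" and r s :: complex
  show "a + b + c = a + (b + c)"
    by (transfer, rule tensor_rel_eqI) (simp add: add.assoc)
  show "a + b = b + a"
    by (transfer, rule tensor_rel_eqI) (simp add: add.commute)
  show "0 + a = a"
    by (transfer, rule tensor_rel_eqI) (simp)
  show "- a + a = 0"
    by (transfer, rule tensor_rel_eqI) (simp)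
  show "a - b = a + - b"
    by (transfer, rule tensor_rel_eqI) (simp)
  show "r *\<^sub>C (a + b) = r *\<^sub>C a + r *\<^sub>C b"
    by (transfer, rule tensor_rel_eqI) (simp add: scaleC_add_right)
  show "(r + s) *\<^sub>C a = r *\<^sub>C a + s *\<^sub>C a"
    by (transfer, rule tensor_rel_eqI) (simp add: scaleC_add_left)
  show "r *\<^sub>C s *\<^sub>C a = (r * s) *\<^sub>C a"
    by (transfer, rule tensor_rel_eqI) (simp add: scaleC_scaleC)
  show "1 *\<^sub>C a = a"
    by (transfer, rule tensor_rel_eqI) (simp add: scaleC_one)
qed

end

lemma tensor_relationsI:
  "gen (x + x') y - gen x y - gen x' y \<in> tensor_relations"
  "gen x (y + y') - gen x y - gen x y' \<in> tensor_relations"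
  "gen (c *\<^sub>C x) y - c *\<^sub>C gen x y \<in> tensor_relations"
  "gen x (c *\<^sub>C y) - c *\<^sub>C gen x y \<in> tensor_relations"
  unfolding tensor_relations_def by blast+

lemma bilinearC_tensor: "bilinearC (\<otimes>\<^sub>t)"
  unfolding bilinearC_iff
proof (intro conjI allI)
  fix x x' :: 'a and y y' :: 'b and c :: complex
  show "(x + x') \<otimes>\<^sub>t y = x \<otimes>\<^sub>t y + x' \<otimes>\<^sub>t y"
    by transfer (simp only: tensor_rel_def diff_diff_eq[symmetric]
        tensor_relationsI complex_vector.span_base)
  show "x \<otimes>\<^sub>t (y + y') = x \<otimes>\<^sub>t y + x \<otimes>\<^sub>t y'"
    by transfer (simp only: tensor_rel_def diff_diff_eq[symmetric]
        tensor_relationsI complex_vector.span_base)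
  show "(c *\<^sub>C x) \<otimes>\<^sub>t y = c *\<^sub>C (x \<otimes>\<^sub>t y)"
    by transfer (simp only: tensor_rel_def tensor_relationsI complex_vector.span_base)
  show "x \<otimes>\<^sub>t (c *\<^sub>C y) = c *\<^sub>C (x \<otimes>\<^sub>t y)"
    by transfer (simp only: tensor_rel_def tensor_relationsI complex_vector.span_base)
qed

subsection \<open>Linear maps out of the tensor product\<close>

definition free_ext :: "('a \<Rightarrow> 'b \<Rightarrow> 'c::complex_vector) \<Rightarrow> (('a \<times> 'b) \<Rightarrow>\<^sub>0 complex) \<Rightarrow> 'c" where
  "free_ext f p = (\<Sum>(x, y)\<in>Poly_Mapping.keys p. Poly_Mapping.lookup p (x, y) *\<^sub>C f x y)"

lemma free_ext_superset:
  assumes "finite K" "Poly_Mapping.keys p \<subseteq> K"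
  shows "free_ext f p = (\<Sum>(x, y)\<in>K. Poly_Mapping.lookup p (x, y) *\<^sub>C f x y)"
  unfolding free_ext_def
  by (rule sum.mono_neutral_left) (use assms in \<open>auto simp: in_keys_iff\<close>)

lemma free_ext_add: "free_ext f (p + q) = free_ext f p + free_ext f q"
proof -
  let ?K = "Poly_Mapping.keys p \<union> Poly_Mapping.keys q"
  have "free_ext f r = (\<Sum>(x, y)\<in>?K. Poly_Mapping.lookup r (x, y) *\<^sub>C f x y)"
    if "Poly_Mapping.keys r \<subseteq> ?K" for r
    using that by (intro free_ext_superset) auto
  then show ?thesis
    using Poly_Mapping.keys_add[of p q]
    by (simp add: lookup_add scaleC_add_left sum.distrib case_prod_unfold)
qed

lemma free_ext_scaleC: "free_ext f (c *\<^sub>C p) = c *\<^sub>C free_ext f p"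
proof -
  have "free_ext f (c *\<^sub>C p) =
      (\<Sum>(x, y)\<in>Poly_Mapping.keys p. Poly_Mapping.lookup (c *\<^sub>C p) (x, y) *\<^sub>C f x y)"
    by (intro free_ext_superset) (auto simp: in_keys_iff scaleC_poly_mapping.rep_eq)
  then show ?thesis
    by (simp add: free_ext_def complex_vector.scale_sum_right case_prod_unfold
        scaleC_poly_mapping.rep_eq scaleC_scaleC)
qed

lemma linearC_free_ext: "Vector_Spaces.linear scaleC scaleC (free_ext f)"
  by (simp add: linearC_iff free_ext_add free_ext_scaleC)

lemma free_ext_gen: "free_ext f (gen x y) = f x y"
  by (simp add: free_ext_def scaleC_one)

lemma free_ext_diff: "free_ext f (p - q) = free_ext f p - free_ext f q"
  using free_ext_add[of f "p - q" q] by simp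

lemma free_ext_span:
  assumes "bilinearC f" "p \<in> complex_vector.span tensor_relations"
  shows "free_ext f p = 0"
  using assms(2)
proof (induction rule: complex_vector.span_induct_alt)
  case base
  then show ?case by (simp add: free_ext_def)
next
  case (step c r s)
  have "free_ext f r = 0"
    using step(1) assms(1)
    by (auto simp: tensor_relations_def free_ext_diff free_ext_scaleC free_ext_gen bilinearC_iff)
  then show ?case
    using step by (simp add: free_ext_add free_ext_scaleC)
qed

text \<open>The linear map induced by a bilinear map; the value on maps that are not bilinear is junk.\<close>

lift_definition tensor_lift ::
  "('a::complex_vector \<Rightarrow> 'b::complex_vector \<Rightarrow> 'c::complex_vector) \<Rightarrow> ('a, 'b) tensor \<Rightarrow> 'c"
  is "\<lambda>f p. if bilinearC f then free_ext f p else 0"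
  by (auto simp: tensor_rel_def free_ext_diff dest: free_ext_span)

lemma tensor_lift_tensor: "bilinearC f \<Longrightarrow> tensor_lift f (x \<otimes>\<^sub>t y) = f x y"
  by transfer (simp add: free_ext_gen)

lemma linearC_tensor_lift: "Vector_Spaces.linear scaleC scaleC (tensor_lift f)"
  unfolding linearC_iff
  by (intro conjI allI; transfer) (simp_all add: free_ext_add free_ext_scaleC)

subsection \<open>The involution on the tensor product\<close>

text \<open>On the free vector space the involution sends
  \<open>\<Sum>c\<^sub>k (x\<^sub>k, y\<^sub>k)\<close> to \<open>\<Sum>cnj c\<^sub>k (star x\<^sub>k, star y\<^sub>k)\<close>; as \<open>star\<close> is an involution, the coefficient
  of \<open>(x, y)\<close> in the image is the conjugate of that of \<open>(star x, star y)\<close>.\<close>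

lift_definition star_free ::
  "(('a::star_vector \<times> 'b::star_vector) \<Rightarrow>\<^sub>0 complex) \<Rightarrow> (('a \<times> 'b) \<Rightarrow>\<^sub>0 complex)"
  is "\<lambda>p (x, y). cnj (p (star x, star y))"
proof -
  fix p :: "'a \<times> 'b \<Rightarrow> complex"
  assume "finite {k. p k \<noteq> 0}"
  then have "finite ((\<lambda>(x, y). (star x, star y)) ` {k. p k \<noteq> 0})"
    by simp
  moreover have "{k. (case k of (x, y) \<Rightarrow> cnj (p (star x, star y))) \<noteq> 0}
      \<subseteq> (\<lambda>(x, y). (star x, star y)) ` {k. p k \<noteq> 0}"
    by (force simp: image_iff)
  ultimately show "finite {k. (case k of (x, y) \<Rightarrow> cnj (p (star x, star y))) \<noteq> 0}"
    by (rule rev_finite_subset)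
qed

lemma star_free_add: "star_free (p + q) = star_free p + star_free q"
  by transfer (auto simp: fun_eq_iff)

lemma star_free_diff: "star_free (p - q) = star_free p - star_free q"
  by transfer (auto simp: fun_eq_iff)

lemma star_free_scaleC: "star_free (c *\<^sub>C p) = cnj c *\<^sub>C star_free p"
  by transfer (auto simp: fun_eq_iff)

lemma star_free_gen: "star_free (gen x y) = gen (star x) (star y)"
  by transfer (auto simp: fun_eq_iff when_def)

lemma star_free_star_free: "star_free (star_free p) = p"
  by transfer (auto simp: fun_eq_iff)

lemma star_free_span:
  assumes "p \<in> complex_vector.span tensor_relations"
  shows "star_free p \<in> complex_vector.span tensor_relations"
  using assms
proof (induction rule: complex_vector.span_induct_alt)
  case base
  have "star_free 0 = (0 :: ('a \<times> 'b) \<Rightarrow>\<^sub>0 complex)"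
    by transfer auto
  then show ?case by (simp add: complex_vector.span_zero)
next
  case (step c r s)
  have "star_free r \<in> tensor_relations"
    using step(1) by (subst (asm) tensor_relations_def)
      (auto simp: star_free_diff star_free_scaleC star_free_gen star_add star_scaleC
        tensor_relationsI)
  then show ?case
    using step by (simp add: star_free_add star_free_scaleC complex_vector.span_add
        complex_vector.span_scale complex_vector.span_base)
qed

instantiation tensor :: (star_vector, star_vector) star_vector
begin

lift_definition star_tensor :: "('a, 'b) tensor \<Rightarrow> ('a, 'b) tensor" is star_free
  unfolding tensor_rel_def by (simp only: star_free_diff[symmetric] star_free_span)

instance
proof
  fix a b :: "('a, 'b) tensor" and c :: complex
  show "star (star a) = a" "star (a + b) = star a + star b" "star (c *\<^sub>C a) = cnj c *\<^sub>C star a"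
    by (transfer, rule tensor_rel_eqI,
        simp add: star_free_add star_free_scaleC star_free_star_free)+
qed

end

lemma star_tensor: "star (x \<otimes>\<^sub>t y) = star x \<otimes>\<^sub>t star y"
  by (transfer, rule tensor_rel_eqI) (rule star_free_gen)


section \<open>Operator systems\<close>

definition sa_mat :: "nat \<Rightarrow> 'a::star_vector mat set" where
  "sa_mat n = {X \<in> carrier_mat n n. \<forall>i<n. \<forall>j<n. star (X $$ (j, i)) = X $$ (i, j)}"

definition scale_mat :: "complex \<Rightarrow> 'a::complex_vector mat \<Rightarrow> 'a mat" where
  "scale_mat c X = map_mat (scaleC c) X"

definition diag_const :: "nat \<Rightarrow> 'a::zero \<Rightarrow> 'a mat" where
  "diag_const n e = mat n n (\<lambda>(i, j). if i = j then e else 0)"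

text \<open>The product \<open>A\<^sup>* X A\<close> of a vector-valued matrix with scalar matrices.\<close>

definition compress :: "complex mat \<Rightarrow> 'a::complex_vector mat \<Rightarrow> 'a mat" where
  "compress A X = mat (dim_col A) (dim_col A) (\<lambda>(i, j).
     \<Sum>k<dim_row A. \<Sum>l<dim_row A. (cnj (A $$ (k, i)) * A $$ (l, j)) *\<^sub>C X $$ (k, l))"

text \<open>Abstract operator systems in the sense of Choi and Effros: a matrix ordered vector space with
  involution together with an Archimedean matrix order unit. The matrix cones are indexed by
  \<open>n \<ge> 1\<close>; nothing is required of \<open>C 0\<close>.\<close>

locale operator_system =
  fixes C :: "nat \<Rightarrow> 'a::star_vector mat set" and e :: 'a
  assumes cone_sa: "n > 0 \<Longrightarrow> C n \<subseteq> sa_mat n"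
    and cone_zero: "n > 0 \<Longrightarrow> 0\<^sub>m n n \<in> C n"
    and cone_add: "n > 0 \<Longrightarrow> X \<in> C n \<Longrightarrow> Y \<in> C n \<Longrightarrow> X + Y \<in> C n"
    and cone_scale: "n > 0 \<Longrightarrow> X \<in> C n \<Longrightarrow> r \<ge> (0::real) \<Longrightarrow> scale_mat (of_real r) X \<in> C n"
    and cone_proper: "n > 0 \<Longrightarrow> X \<in> C n \<Longrightarrow> - X \<in> C n \<Longrightarrow> X = 0\<^sub>m n n"
    and cone_compress:
      "n > 0 \<Longrightarrow> m > 0 \<Longrightarrow> A \<in> carrier_mat n m \<Longrightarrow> X \<in> C n \<Longrightarrow> compress A X \<in> C m"
    and unit_sa: "star e = e"
    and unit_order:
      "n > 0 \<Longrightarrow> X \<in> sa_mat n \<Longrightarrow> \<exists>r>0. scale_mat (of_real r) (diag_const n e) - X \<in> C n"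
    and unit_archimedean:
      "n > 0 \<Longrightarrow> X \<in> sa_mat n \<Longrightarrow>
        (\<And>r::real. r > 0 \<Longrightarrow> scale_mat (of_real r) (diag_const n e) + X \<in> C n) \<Longrightarrow> X \<in> C n"

definition base_cone :: "(nat \<Rightarrow> 'a mat set) \<Rightarrow> 'a set" where
  "base_cone C = {x. mat 1 1 (\<lambda>_. x) \<in> C 1}"


section \<open>Unital completely positive maps into matrix algebras\<close>

definition psd :: "nat \<Rightarrow> complex mat \<Rightarrow> bool" where
  "psd n A \<longleftrightarrow> A \<in> carrier_mat n n \<and> (\<forall>v \<in> carrier_vec n. 0 \<le> (A *\<^sub>v v) \<bullet>c v)"

definition mat_linear :: "nat \<Rightarrow> ('a::complex_vector \<Rightarrow> complex mat) \<Rightarrow> bool" where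
  "mat_linear n \<phi> \<longleftrightarrow> (\<forall>x. \<phi> x \<in> carrier_mat n n) \<and>
     (\<forall>x y. \<phi> (x + y) = \<phi> x + \<phi> y) \<and> (\<forall>c x. \<phi> (c *\<^sub>C x) = c \<cdot>\<^sub>m \<phi> x)"

text \<open>The \<open>k\<close>-th amplification of a map into the \<open>n \<times> n\<close> matrices, where \<open>k \<times> k\<close> matrices with
  \<open>n \<times> n\<close> blocks are identified with \<open>kn \<times> kn\<close> matrices.\<close>

definition amplify :: "nat \<Rightarrow> nat \<Rightarrow> ('a \<Rightarrow> complex mat) \<Rightarrow> 'a mat \<Rightarrow> complex mat" where
  "amplify k n \<phi> X = mat (k * n) (k * n) (\<lambda>(i, j).
     \<phi> (X $$ (i div n, j div n)) $$ (i mod n, j mod n))"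

definition ucp :: "(nat \<Rightarrow> 'a::star_vector mat set) \<Rightarrow> 'a \<Rightarrow> nat \<Rightarrow> ('a \<Rightarrow> complex mat) \<Rightarrow> bool" where
  "ucp C e n \<phi> \<longleftrightarrow> mat_linear n \<phi> \<and> \<phi> e = 1\<^sub>m n \<and>
     (\<forall>k>0. \<forall>X \<in> C k. psd (k * n) (amplify k n \<phi> X))"


section \<open>Operator system tensor product structures\<close>

text \<open>The Kronecker product with respect to a given product of entries.\<close>

definition kron :: "('a \<Rightarrow> 'b \<Rightarrow> 'c) \<Rightarrow> 'a mat \<Rightarrow> 'b mat \<Rightarrow> 'c mat" where
  "kron f A B = mat (dim_row A * dim_row B) (dim_col A * dim_col B) (\<lambda>(i, j).
     f (A $$ (i div dim_row B, j div dim_col B)) (B $$ (i mod dim_row B, j mod dim_col B)))"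

text \<open>\<open>\<phi> \<otimes> \<psi>\<close>, with the tensor product of the \<open>n\<^sub>1 \<times> n\<^sub>1\<close> and the \<open>n\<^sub>2 \<times> n\<^sub>2\<close> matrices identified with
  the \<open>n\<^sub>1n\<^sub>2 \<times> n\<^sub>1n\<^sub>2\<close> matrices via the Kronecker product.\<close>

definition tensor_map_mat ::
  "nat \<Rightarrow> nat \<Rightarrow> ('a::complex_vector \<Rightarrow> complex mat) \<Rightarrow> ('b::complex_vector \<Rightarrow> complex mat) \<Rightarrow>
     ('a, 'b) tensor \<Rightarrow> complex mat" where
  "tensor_map_mat n1 n2 \<phi> \<psi> z = mat (n1 * n2) (n1 * n2) (\<lambda>ij.
     tensor_lift (\<lambda>x y. kron (*) (\<phi> x) (\<psi> y) $$ ij) z)"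

lemma tensor_map_mat_tensor:
  assumes "mat_linear n1 \<phi>" "mat_linear n2 \<psi>"
  shows "tensor_map_mat n1 n2 \<phi> \<psi> (x \<otimes>\<^sub>t y) = kron (*) (\<phi> x) (\<psi> y)"
proof -
  have dim: "dim_row (\<phi> x) = n1" "dim_col (\<phi> x) = n1" "dim_row (\<psi> y) = n2" "dim_col (\<psi> y) = n2"
    for x y
    using assms by (auto simp: mat_linear_def)
  have bil: "bilinearC (\<lambda>x y. kron (*) (\<phi> x) (\<psi> y) $$ (i, j))" if "i < n1 * n2" "j < n1 * n2" for i j
  proof -
    have "n2 > 0" using that by (cases n2) auto
    then have "i mod n2 < n2" "j mod n2 < n2" "i div n2 < n1" "j div n2 < n1"
      using that by (auto simp: less_mult_imp_div_less)
    then show ?thesis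
      using assms that by (simp add: bilinearC_iff kron_def dim mat_linear_def algebra_simps)
  qed
  have kdim: "dim_row (kron (*) (\<phi> x) (\<psi> y)) = n1 * n2" "dim_col (kron (*) (\<phi> x) (\<psi> y)) = n1 * n2"
    by (simp_all add: kron_def dim)
  show ?thesis
    by (rule eq_matI) (simp_all add: tensor_map_mat_def kdim bil tensor_lift_tensor)
qed

locale operator_system_tensor_structure =
  R: operator_system R eR + T: operator_system T eT + S: operator_system S "eR \<otimes>\<^sub>t eT"
  for R :: "nat \<Rightarrow> 'r::star_vector mat set" and eR :: 'r
    and T :: "nat \<Rightarrow> 't::star_vector mat set" and eT :: 't
    and S :: "nat \<Rightarrow> ('r, 't) tensor mat set" +
  assumes kron_mem:
      "n1 > 0 \<Longrightarrow> n2 > 0 \<Longrightarrow> a \<in> R n1 \<Longrightarrow> b \<in> T n2 \<Longrightarrow> kron (\<otimes>\<^sub>t) a b \<in> S (n1 * n2)"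
    and ucp_tensor:
      "n1 > 0 \<Longrightarrow> n2 > 0 \<Longrightarrow> ucp R eR n1 \<phi> \<Longrightarrow> ucp T eT n2 \<psi> \<Longrightarrow>
        ucp S (eR \<otimes>\<^sub>t eT) (n1 * n2) (tensor_map_mat n1 n2 \<phi> \<psi>)"


section \<open>Tensor cones\<close>

definition sep_cone ::
  "'a::star_vector set \<Rightarrow> 'b::star_vector set \<Rightarrow> ('a, 'b) tensor set" where
  "sep_cone P Q = {\<Sum>j<k. a j \<otimes>\<^sub>t b j | (k::nat) a b. \<forall>j<k. a j \<in> P \<and> b j \<in> Q}"

definition positive_functional :: "'a::complex_vector set \<Rightarrow> ('a \<Rightarrow> complex) \<Rightarrow> bool" where
  "positive_functional P \<phi> \<longleftrightarrow> Vector_Spaces.linear scaleC scaleC \<phi> \<and> (\<forall>x\<in>P. 0 \<le> \<phi> x)"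

definition dual_sep_cone ::
  "'a::star_vector set \<Rightarrow> 'b::star_vector set \<Rightarrow> ('a, 'b) tensor set" where
  "dual_sep_cone P Q = {z. star z = z \<and>
     (\<forall>\<phi> \<psi>. positive_functional P \<phi> \<longrightarrow> positive_functional Q \<psi> \<longrightarrow>
        0 \<le> tensor_lift (\<lambda>x y. \<phi> x * \<psi> y) z)}"

definition is_cone :: "'a::complex_vector set \<Rightarrow> bool" where
  "is_cone K \<longleftrightarrow> 0 \<in> K \<and> (\<forall>x\<in>K. \<forall>y\<in>K. x + y \<in> K) \<and> (\<forall>r\<ge>0. \<forall>x\<in>K. of_real r *\<^sub>C x \<in> K)"

definition tensor_cone ::
  "'a::star_vector set \<Rightarrow> 'b::star_vector set \<Rightarrow> ('a, 'b) tensor set \<Rightarrow> bool" where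
  "tensor_cone P Q K \<longleftrightarrow> is_cone K \<and> sep_cone P Q \<subseteq> K \<and> K \<subseteq> dual_sep_cone P Q"

end

(* The lower inclusion is the compatibility of the matrix cones with Kronecker products at n = 1.
   For the upper one, a positive functional phi on an operator system either vanishes at the order
   unit, and then it is zero, or phi / phi(e) is a ucp map into the 1 x 1 matrices: a quadratic form
   of the amplified matrix at v is the value of phi at the compression by the column v. The tensor
   product of two such ucp maps is positive on the base cone. *)
theory Submission
  imports Defs
begin

lemma mat_1_1_add: "mat 1 1 (\<lambda>_. x) + mat 1 1 (\<lambda>_. y) = mat 1 1 (\<lambda>_. x + y)"
  by (rule eq_matI) auto

text \<open>Each cone axiom at n = 1, carried over along the identification of a vector with the 1 x
  1 matrix that has it as entry.\<close>

lemma (in operator_system) is_cone_base_cone: "is_cone (base_cone C)"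
  unfolding is_cone_def
proof (intro conjI ballI allI impI)
  have "mat 1 1 (\<lambda>_. 0) = (0\<^sub>m 1 1 :: 'a mat)"
    by (rule eq_matI) auto
  then show "0 \<in> base_cone C"
    using cone_zero[of 1] by (simp add: base_cone_def)
next
  fix x y assume "x \<in> base_cone C" "y \<in> base_cone C"
  then show "x + y \<in> base_cone C"
    using cone_add[of 1 "mat 1 1 (\<lambda>_. x)" "mat 1 1 (\<lambda>_. y)"]
    by (simp only: base_cone_def mem_Collect_eq mat_1_1_add zero_less_one)
next
  fix r :: real and x assume "0 \<le> r" "x \<in> base_cone C"
  moreover have "scale_mat (of_real r) (mat 1 1 (\<lambda>_. x)) = mat 1 1 (\<lambda>_. of_real r *\<^sub>C x)"
    by (rule eq_matI) (auto simp: scale_mat_def)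
  ultimately show "of_real r *\<^sub>C x \<in> base_cone C"
    using cone_scale[of 1 _ r] by (fastforce simp: base_cone_def)
qed

lemma is_cone_sum:
  assumes "is_cone K" "\<And>j. j \<in> A \<Longrightarrow> f j \<in> K"
  shows "sum f A \<in> K"
  \<comment> \<open>For an infinite index set the sum is 0 by convention, and 0 lies in every
    cone.\<close>
  using assms(2) by (induction A rule: infinite_finite_induct) (use assms(1) in \<open>auto simp: is_cone_def\<close>)

lemma (in operator_system) star_base_cone: "x \<in> base_cone C \<Longrightarrow> star x = x"
  using cone_sa[of 1] by (auto simp: base_cone_def sa_mat_def)

text \<open>The order unit axiom at n = 1, stated for vectors instead of matrices.\<close>

lemma (in operator_system) base_cone_order_unit:
  assumes "star x = x"
  obtains r :: real where "r > 0" "of_real r *\<^sub>C e - x \<in> base_cone C"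
proof -
  have "mat 1 1 (\<lambda>_. x) \<in> sa_mat 1"
    using assms by (auto simp: sa_mat_def)
  then obtain r :: real where "r > 0"
    and "scale_mat (of_real r) (diag_const 1 e) - mat 1 1 (\<lambda>_. x) \<in> C 1"
    using unit_order[of 1] by auto
  moreover have "scale_mat (of_real r) (diag_const 1 e) - mat 1 1 (\<lambda>_. x)
      = mat 1 1 (\<lambda>_. of_real r *\<^sub>C e - x)"
    by (rule eq_matI) (auto simp: scale_mat_def diag_const_def)
  ultimately show ?thesis
    using that by (auto simp: base_cone_def)
qed

lemma (in operator_system) unit_in_base_cone: "e \<in> base_cone C"
proof -
  \<comment> \<open>The order unit dominates 0, so some positive multiple of \<open>e\<close> is in
    the cone; rescaling by \<open>1 / r\<close> gives \<open>e\<close> itself.\<close>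
  obtain r :: real where r: "r > 0" "of_real r *\<^sub>C e - 0 \<in> base_cone C"
    using base_cone_order_unit[of 0] by auto
  moreover have "0 \<le> 1 / r"
    using r(1) by simp
  ultimately have "of_real (1 / r) *\<^sub>C of_real r *\<^sub>C e \<in> base_cone C"
    using is_cone_base_cone unfolding is_cone_def diff_zero by blast
  then show ?thesis
    using r by (simp add: scaleC_scaleC scaleC_one)
qed

text \<open>Every self-adjoint y is dominated by a multiple of \<open>e\<close>, where \<phi>
  vanishes; applying this to y and -y kills \<phi> on self-adjoint elements, and these span the
  space over the complex numbers.\<close>

lemma (in operator_system) positive_functional_eq_0:
  assumes \<phi>: "positive_functional (base_cone C) \<phi>" and "\<phi> e = 0"
  shows "\<phi> x = 0"
proof -
  interpret \<phi>: Vector_Spaces.linear scaleC scaleC \<phi>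
    using \<phi> by (simp add: positive_functional_def)
  \<comment> \<open>In the order on complex numbers, comparable numbers have equal imaginary parts,
    so this also says that \<open>\<phi> y\<close> is real.\<close>
  have nonpos: "\<phi> y \<le> 0" if "star y = y" for y
  proof -
    obtain r :: real where "r > 0" "of_real r *\<^sub>C e - y \<in> base_cone C"
      by (rule base_cone_order_unit[OF \<open>star y = y\<close>])
    from this(2) have "0 \<le> \<phi> (of_real r *\<^sub>C e - y)"
      using \<phi> by (simp add: positive_functional_def)
    then show ?thesis
      using \<open>\<phi> e = 0\<close> by (simp add: \<phi>.diff \<phi>.scale)
  qed
  have star_minus: "star (- y) = - star y" for y :: 'a
    using star_scaleC[of "-1" y] by (simp add: scaleC_one)
  have sa: "\<phi> y = 0" if "star y = y" for y
  proof (rule order_antisym)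
    show "\<phi> y \<le> 0"
      using that by (rule nonpos)
    have "\<phi> (- y) \<le> 0"
      using that by (intro nonpos) (simp only: star_minus)
    then show "0 \<le> \<phi> y"
      by (simp add: \<phi>.neg less_eq_complex_def)
  qed
  have star_diff: "star (x - star x) = - (x - star x)"
    using star_add[of x "- star x"] by (simp add: star_minus)
  \<comment> \<open>Twice the real part of x, and up to sign twice the imaginary part, are
    self-adjoint; if \<phi> vanishes on both, then \<open>2 * \<phi> x = 0\<close>.\<close>
  have "star (x + star x) = x + star x"
    by (simp add: star_add add.commute)
  moreover have "star (\<i> *\<^sub>C (x - star x)) = \<i> *\<^sub>C (x - star x)"
    unfolding star_scaleC star_diff by (simp add: complex_vector.scale_right_diff_distrib)
  ultimately have "\<phi> (x + star x) = 0" "\<phi> (\<i> *\<^sub>C (x - star x)) = 0"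
    by (simp_all only: sa)
  then show ?thesis
    by (simp add: \<phi>.add \<phi>.diff \<phi>.scale)
qed

text \<open>Complex numbers become 1 x 1 matrices here because \<open>ucp\<close> speaks only of
  matrix-valued maps.\<close>

definition mat_of_functional :: "('a \<Rightarrow> complex) \<Rightarrow> 'a \<Rightarrow> complex mat" where
  "mat_of_functional \<phi> x = mat 1 1 (\<lambda>_. \<phi> x)"

lemma mat_linear_mat_of_functional:
  "Vector_Spaces.linear scaleC scaleC \<phi> \<Longrightarrow> mat_linear 1 (mat_of_functional \<phi>)"
  by (auto simp: mat_linear_def mat_of_functional_def linearC_iff intro!: eq_matI)

lemma (in operator_system) ucp_mat_of_functional:
  assumes \<phi>: "positive_functional (base_cone C) \<phi>" and "\<phi> e = 1"
  shows "ucp C e 1 (mat_of_functional \<phi>)"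
  unfolding ucp_def
proof (intro conjI allI impI ballI)
  have lin: "Vector_Spaces.linear scaleC scaleC \<phi>"
    using \<phi> by (simp add: positive_functional_def)
  then show "mat_linear 1 (mat_of_functional \<phi>)"
    by (rule mat_linear_mat_of_functional)
  show "mat_of_functional \<phi> e = 1\<^sub>m 1"
    using \<open>\<phi> e = 1\<close> by (auto simp: mat_of_functional_def intro!: eq_matI)
  interpret \<phi>: Vector_Spaces.linear scaleC scaleC \<phi> by fact
  fix k :: nat and X assume "k > 0" and X: "X \<in> C k"
  have amp: "amplify k 1 (mat_of_functional \<phi>) X = mat k k (\<lambda>ij. \<phi> (X $$ ij))"
    by (rule eq_matI) (auto simp: amplify_def mat_of_functional_def)
  have "0 \<le> (amplify k 1 (mat_of_functional \<phi>) X *\<^sub>v v) \<bullet>c v" if v: "v \<in> carrier_vec k" for v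
  proof -
    \<comment> \<open>With \<open>v\<close> as the single column of \<open>?A\<close>, the
      compression of \<open>X\<close> is the 1 x 1 matrix with entry v* X v, an element of the base
      cone.\<close>
    let ?A = "mat k 1 (\<lambda>(i, _). v $ i)"
    let ?x = "\<Sum>i<k. \<Sum>j<k. (cnj (v $ i) * v $ j) *\<^sub>C X $$ (i, j)"
    have "compress ?A X = mat 1 1 (\<lambda>_. ?x)"
      by (rule eq_matI) (auto simp: compress_def)
    then have "?x \<in> base_cone C"
      using cone_compress[of k 1 ?A X] \<open>k > 0\<close> X by (simp add: base_cone_def)
    then have "0 \<le> \<phi> ?x"
      using \<phi> by (simp add: positive_functional_def)
    also have "\<phi> ?x = (\<Sum>i<k. \<Sum>j<k. cnj (v $ i) * v $ j * \<phi> (X $$ (i, j)))"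
      by (simp add: \<phi>.sum \<phi>.scale)
    also have "\<dots> = (amplify k 1 (mat_of_functional \<phi>) X *\<^sub>v v) \<bullet>c v"
      unfolding amp using v
      by (auto simp: scalar_prod_def sum_distrib_right sum_distrib_left atLeast0LessThan mult_ac
          intro!: sum.cong)
    finally show ?thesis .
  qed
  then show "psd (k * 1) (amplify k 1 (mat_of_functional \<phi>) X)"
    by (simp add: psd_def) (simp add: amplify_def)
qed

lemma bilinearC_mult:
  fixes \<phi> :: "'a::complex_vector \<Rightarrow> complex" and \<psi> :: "'b::complex_vector \<Rightarrow> complex"
  assumes "Vector_Spaces.linear scaleC scaleC \<phi>" "Vector_Spaces.linear scaleC scaleC \<psi>"
  shows "bilinearC (\<lambda>x y. \<phi> x * \<psi> y)"
  using assms by (simp add: bilinearC_iff linearC_iff algebra_simps)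

text \<open>Used with c = 0 to annihilate a lift, and with c = \<open>\<phi> eR * \<psi> eT\<close>
  to undo a normalization.\<close>

lemma tensor_lift_scaleC:
  assumes "bilinearC f"
  shows "tensor_lift (\<lambda>x y. c *\<^sub>C f x y) z = c *\<^sub>C tensor_lift f z"
proof -
  have "bilinearC (\<lambda>x y. c *\<^sub>C f x y)"
    using assms by (simp add: bilinearC_iff scaleC_add_right scaleC_scaleC mult.commute)
  with assms show ?thesis
    by transfer (simp add: free_ext_def complex_vector.scale_sum_right scaleC_scaleC
        case_prod_unfold mult.commute)
qed

lemma (in operator_system) ucp_normalized_functional:
  assumes \<phi>: "positive_functional (base_cone C) \<phi>" and "\<phi> e \<noteq> 0"
  shows "ucp C e 1 (mat_of_functional (\<lambda>x. \<phi> x / \<phi> e))"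
proof (rule ucp_mat_of_functional)
  \<comment> \<open>Being nonnegative and nonzero, \<open>\<phi> e\<close> is a positive real, so
    division by it preserves positivity.\<close>
  have "0 \<le> \<phi> e"
    using \<phi> unit_in_base_cone by (simp add: positive_functional_def)
  then have "0 \<le> \<phi> x / \<phi> e" if "0 \<le> \<phi> x" for x
    using that by (auto simp: less_eq_complex_def complex_eq_iff Re_divide Im_divide)
  then show "positive_functional (base_cone C) (\<lambda>x. \<phi> x / \<phi> e)"
    using \<phi> by (auto simp: positive_functional_def linearC_iff add_divide_distrib)
qed (use assms in simp)

lemma tensor_map_mat_of_functional:
  "tensor_map_mat 1 1 (mat_of_functional \<phi>) (mat_of_functional \<psi>) z
     = mat 1 1 (\<lambda>_. tensor_lift (\<lambda>x y. \<phi> x * \<psi> y) z)"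
  by (rule eq_matI) (auto simp: tensor_map_mat_def mat_of_functional_def kron_def)

text \<open>At the unit vector the quadratic form takes the value \<open>a\<close>.\<close>

lemma psd_mat_1_1: "psd 1 (mat 1 1 (\<lambda>_. a)) \<Longrightarrow> 0 \<le> a"
  by (auto simp: psd_def scalar_prod_def dest!: bspec[of _ _ "unit_vec 1 0"])

context operator_system_tensor_structure
begin

text \<open>The Kronecker product of 1 x 1 matrices is the elementary tensor of their entries, and
  the base cone is closed under finite sums.\<close>

lemma sep_cone_subset: "sep_cone (base_cone R) (base_cone T) \<subseteq> base_cone S"
proof -
  have "a \<otimes>\<^sub>t b \<in> base_cone S" if "a \<in> base_cone R" "b \<in> base_cone T" for a b
  proof -
    have "kron (\<otimes>\<^sub>t) (mat 1 1 (\<lambda>_. a)) (mat 1 1 (\<lambda>_. b)) = mat 1 1 (\<lambda>_. a \<otimes>\<^sub>t b)"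
      by (rule eq_matI) (auto simp: kron_def)
    then show ?thesis
      using kron_mem[of 1 1] that by (fastforce simp: base_cone_def)
  qed
  then show ?thesis
    by (auto simp: sep_cone_def intro!: is_cone_sum S.is_cone_base_cone)
qed

lemma tensor_lift_nonneg:
  assumes z: "z \<in> base_cone S"
    and \<phi>: "positive_functional (base_cone R) \<phi>" and \<psi>: "positive_functional (base_cone T) \<psi>"
  shows "0 \<le> tensor_lift (\<lambda>x y. \<phi> x * \<psi> y) z"
proof -
  have lin: "Vector_Spaces.linear scaleC scaleC \<phi>" "Vector_Spaces.linear scaleC scaleC \<psi>"
    using \<phi> \<psi> by (simp_all add: positive_functional_def)
  note bil = bilinearC_mult[OF this]
  show ?thesis
  proof (cases "\<phi> eR = 0 \<or> \<psi> eT = 0")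
    case True
    \<comment> \<open>One factor is the zero functional, so the product is 0 times itself and its
      lift is 0 as well.\<close>
    then have "(\<lambda>x y. \<phi> x * \<psi> y) = (\<lambda>x y. 0 *\<^sub>C (\<phi> x * \<psi> y))"
      using R.positive_functional_eq_0[OF \<phi>] T.positive_functional_eq_0[OF \<psi>]
      by (auto simp: fun_eq_iff)
    then show ?thesis
      using tensor_lift_scaleC[OF bil, of 0 z] by simp
  next
    case False
    let ?\<phi> = "\<lambda>x. \<phi> x / \<phi> eR" and ?\<psi> = "\<lambda>y. \<psi> y / \<psi> eT"
    let ?m = "tensor_map_mat 1 1 (mat_of_functional ?\<phi>) (mat_of_functional ?\<psi>)"
    \<comment> \<open>The nonnegative factor lost by normalizing both functionals; it is restored at
      the end.\<close>
    let ?c = "\<phi> eR * \<psi> eT"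
    have "0 \<le> ?c"
      using \<phi> \<psi> R.unit_in_base_cone T.unit_in_base_cone by (simp add: positive_functional_def)
    have "ucp S (eR \<otimes>\<^sub>t eT) (1 * 1) ?m"
      using False R.ucp_normalized_functional[OF \<phi>] T.ucp_normalized_functional[OF \<psi>]
      by (intro ucp_tensor) auto
    \<comment> \<open>The first amplification suffices, since it contains the value of the map at
      \<open>z\<close>.\<close>
    then have "psd 1 (amplify 1 1 ?m (mat 1 1 (\<lambda>_. z)))"
      using z by (simp add: ucp_def base_cone_def)
    moreover have "amplify 1 1 ?m (mat 1 1 (\<lambda>_. z))
        = mat 1 1 (\<lambda>_. tensor_lift (\<lambda>x y. ?\<phi> x * ?\<psi> y) z)"
      unfolding tensor_map_mat_of_functional by (rule eq_matI) (auto simp: amplify_def)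
    ultimately have nonneg: "0 \<le> tensor_lift (\<lambda>x y. ?\<phi> x * ?\<psi> y) z"
      using psd_mat_1_1 by simp
    have "bilinearC (\<lambda>x y. ?\<phi> x * ?\<psi> y)"
      using lin by (intro bilinearC_mult) (auto simp: linearC_iff add_divide_distrib)
    from tensor_lift_scaleC[OF this, of ?c z]
    have "tensor_lift (\<lambda>x y. \<phi> x * \<psi> y) z = ?c * tensor_lift (\<lambda>x y. ?\<phi> x * ?\<psi> y) z"
      using False by (simp add: field_simps)
    then show ?thesis
      using \<open>0 \<le> ?c\<close> nonneg by simp
  qed
qed

text \<open>Self-adjointness of the elements comes from the first matrix cone of \<open>S\<close>
  lying in \<open>sa_mat 1\<close>.\<close>

lemma base_cone_subset_dual: "base_cone S \<subseteq> dual_sep_cone (base_cone R) (base_cone T)"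
  by (auto simp: dual_sep_cone_def S.star_base_cone tensor_lift_nonneg)

end

theorem theorem1p6:
  fixes R :: "nat \<Rightarrow> 'r::star_vector mat set" and eR :: 'r
    and T :: "nat \<Rightarrow> 't::star_vector mat set" and eT :: 't
    and S :: "nat \<Rightarrow> ('r, 't) tensor mat set"
  assumes "operator_system R eR" and "\<exists>B :: 'r set. finite_dimensional_vector_space scaleC B"
    and "operator_system T eT" and "\<exists>B :: 't set. finite_dimensional_vector_space scaleC B"
    and "operator_system_tensor_structure R eR T eT S"
  shows "sep_cone (base_cone R) (base_cone T) \<subseteq> base_cone S \<and>
    base_cone S \<subseteq> dual_sep_cone (base_cone R) (base_cone T) \<and>
    tensor_cone (base_cone R) (base_cone T) (base_cone S)"
proof -
  interpret operator_system_tensor_structure R eR T eT S by fact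
  show ?thesis
    using sep_cone_subset base_cone_subset_dual S.is_cone_base_cone by (simp add: tensor_cone_def)
qed

end
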